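(* Let $k\ge1$, let $\lambda,\mu\in\mathcal P^k$ be $k$-bounded partitions and let $\square$ be any $k$-rectangle. Then $\lambda\preceq\mu$ if and only if $(\lambda\cup\square)\preceq(\mu\cup\square)$.
   Context: Fix an integer $k\ge1$. A partition $\lambda=(\lambda_1\ge\dots\ge\lambda_\ell>0)$ is a finite (possibly empty) non-increasing sequence of positive integers, $|\lambda|=\sum_i\lambda_i$, $\ell(\lambda)$ is the number of parts, and $\lambda_i=0$ for $i>\ell(\lambda)$. Its diagram is the set of cells $(i,j)$ with $1\le j\le\lambda_i$ (row $i$, column $j$; row 1 is the lowest row, and "above" means larger row index). $\lambda\subseteq\mu$ means $\lambda_i\le\mu_i$ for all $i$. A partition is $k$-bounded if $\lambda_1\le k$; $\mathcal P^k$ is the set of $k$-bounded partitions. $\lambda\cup\mu$ is the partition obtained by sorting all the parts of $\lambda$ and $\mu$ together in non-increasing order. A $k$-rectangle is a partition $(\ell^{k-\ell+1})$ ($k-\ell+1$ parts equal to $\ell$) with $1\le\ell\le k$. For partitions $\rho\subseteq\gamma$, the skew diagram $\gamma/\rho$ is $\{(i,j):\rho_i<j\le\gamma_i\}$; the squares of $\rho$ are said to lie below $\gamma/\rho$. For a square $(i,j)\in\gamma$ (possibly in $\rho$), its hook-length in $\gamma/\rho$ is the number of cells of $\gamma/\rho$ of the form $(i,j')$ with $j'\ge j$ or $(i',j)$ with $i'\ge i$. For $\lambda\in\mathcal P^k$, the $k$-skew diagram $\lambda/^k$ is the unique skew diagram such that (i) row $i$ has $\lambda_i$ cells, (ii)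 no cell of the diagram has hook-length exceeding $k$, (iii) every square below the diagram has hook-length exceeding $k$. The column lengths of $\lambda/^k$ form a $k$-bounded partition, called the $k$-conjugate $\lambda^{\omega_k}$. For $\lambda,\mu\in\mathcal P^k$ write $\lambda\prec\!\!\cdot\,\mu$ when $\lambda\subseteq\mu$, $\lambda^{\omega_k}\subseteq\mu^{\omega_k}$ and $|\mu|-|\lambda|=1$. The partial order $\preceq$ on $\mathcal P^k$ is the reflexive-transitive closure of $\prec\!\!\cdot$. *)

theory Defs
  imports Main
begin

definition is_partition :: "nat list \<Rightarrow> bool" where
  "is_partition p \<longleftrightarrow> sorted_wrt (\<ge>) p \<and> (\<forall>x\<in>set p. 0 < x)"

(* Parts are numbered from 1; part p i = 0 for i beyond the number of parts. *)
definition part :: "nat list \<Rightarrow> nat \<Rightarrow> nat" where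
  "part p i = (if 1 \<le> i \<and> i \<le> length p then p ! (i - 1) else 0)"

definition contained :: "nat list \<Rightarrow> nat list \<Rightarrow> bool" where
  "contained p q \<longleftrightarrow> (\<forall>i\<ge>1. part p i \<le> part q i)"

definition k_bounded_partitions :: "nat \<Rightarrow> nat list set" where
  "k_bounded_partitions k = {p. is_partition p \<and> part p 1 \<le> k}"

definition partition_union :: "nat list \<Rightarrow> nat list \<Rightarrow> nat list" where
  "partition_union p q = rev (sort (p @ q))"

definition k_rectangle :: "nat \<Rightarrow> nat list \<Rightarrow> bool" where
  "k_rectangle k r \<longleftrightarrow> (\<exists>l. 1 \<le> l \<and> l \<le> k \<and> r = replicate (k - l + 1) l)"

(* A cell is a pair (row, column), both numbered from 1. *)
definition diagram :: "nat list \<Rightarrow> (nat \<times> nat) set" where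
  "diagram p = {(i, j). 1 \<le> i \<and> 1 \<le> j \<and> j \<le> part p i}"

definition skew_diagram :: "nat list \<Rightarrow> nat list \<Rightarrow> (nat \<times> nat) set" where
  "skew_diagram \<gamma> \<rho> = {(i, j). 1 \<le> i \<and> part \<rho> i < j \<and> j \<le> part \<gamma> i}"

(* Only cells of the skew diagram are counted, even when (i, j) lies below it. *)
definition hook_length :: "nat list \<Rightarrow> nat list \<Rightarrow> nat \<Rightarrow> nat \<Rightarrow> nat" where
  "hook_length \<gamma> \<rho> i j =
     card {(i', j') \<in> skew_diagram \<gamma> \<rho>. (i' = i \<and> j \<le> j') \<or> (i \<le> i' \<and> j' = j)}"

definition is_k_skew :: "nat \<Rightarrow> nat list \<Rightarrow> nat list \<Rightarrow> nat list \<Rightarrow> bool" where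
  "is_k_skew k p \<gamma> \<rho> \<longleftrightarrow>
     is_partition \<gamma> \<and> is_partition \<rho> \<and> contained \<rho> \<gamma> \<and>
     (\<forall>i\<ge>1. card {j. (i, j) \<in> skew_diagram \<gamma> \<rho>} = part p i) \<and>
     (\<forall>(i, j) \<in> skew_diagram \<gamma> \<rho>. hook_length \<gamma> \<rho> i j \<le> k) \<and>
     (\<forall>(i, j) \<in> diagram \<rho>. k < hook_length \<gamma> \<rho> i j)"

(* The pair (\<gamma>, \<rho>) itself is unique, not just the set of cells: squares of \<rho> in a row
   above all cells of the skew diagram would have hook-length 0, so \<rho> has no such rows. *)
definition k_skew :: "nat \<Rightarrow> nat list \<Rightarrow> nat list \<times> nat list" where
  "k_skew k p = (THE (\<gamma>, \<rho>). is_k_skew k p \<gamma> \<rho>)"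

(* The columns of the k-skew diagram are 1, ..., part \<gamma> 1 (the first row of \<gamma> is its longest);
   their lengths are listed from left to right. *)
definition k_conjugate :: "nat \<Rightarrow> nat list \<Rightarrow> nat list" where
  "k_conjugate k p =
     (case k_skew k p of (\<gamma>, \<rho>) \<Rightarrow>
        map (\<lambda>j. card {i. (i, j) \<in> skew_diagram \<gamma> \<rho>}) [1..<part \<gamma> 1 + 1])"

definition k_cover :: "nat \<Rightarrow> nat list \<Rightarrow> nat list \<Rightarrow> bool" where
  "k_cover k p q \<longleftrightarrow>
     p \<in> k_bounded_partitions k \<and> q \<in> k_bounded_partitions k \<and>
     contained p q \<and> contained (k_conjugate k p) (k_conjugate k q) \<and>
     sum_list q = sum_list p + 1"

definition k_le :: "nat \<Rightarrow> nat list \<Rightarrow> nat list \<Rightarrow> bool" where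
  "k_le k = (k_cover k)\<^sup>*\<^sup>*"

end

theory Submission
  imports Defs "HOL-Library.Multiset"
begin

text \<open>
  The \<open>k\<close>-skew diagram of \<open>\<lambda>\<close> is built by inserting its rows one at a time below the ones already
  placed, starting with the shortest. A new row of length \<open>a\<close> cannot pass below a column of height
  more than \<open>k - a\<close>, because the hook would exceed \<open>k\<close>, and it must begin immediately to the right of
  these columns, because the squares to its left need hooks exceeding \<open>k\<close>. So the row raises by
  one every column of height at most \<open>k - a\<close> and starts new columns with its remaining cells. In this
  description (\<open>add_row\<close>, shown to compute the \<open>k\<close>-conjugate in \<open>k_conjugate_eq_columns\<close>) only the
  multiset of column heights matters.

  Let the rectangle consist of \<open>n = k - l + 1\<close> rows of length \<open>l\<close>. When the rows of length at most
  \<open>l\<close> have been placed, at most \<open>l\<close> columns have height below \<open>n\<close>; complete them to \<open>l\<close> columns by columns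
  of height 0. A row of length \<open>l\<close> raises each of these \<open>l\<close> columns by one, and a column that reaches
  height \<open>n\<close> is out of reach of further rows of length \<open>l\<close> and is replaced by a new column of height 0.
  The low heights thus rotate modulo \<open>n\<close>, and after the \<open>n\<close> rows of the rectangle they are back
  where they started, while \<open>l\<close> columns of height \<open>n\<close> have been added. Longer rows never touch columns of
  height \<open>n\<close>. Hence inserting the rectangle into \<open>\<lambda>\<close> adds \<open>l\<close> parts \<open>n\<close> to the \<open>k\<close>-conjugate
  (\<open>columns_partition_union_rectangle\<close>). Containment of partitions is a comparison of the numbers of
  parts \<open>\<ge> t\<close> for all \<open>t\<close>, so adding common parts to both sides does not affect it, and inserting the
  rectangle both preserves and reflects covers (\<open>k_cover_partition_union_rectangle\<close>).

  It remains to see that a chain that begins at a partition containing the rectangle never leaves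
  the partitions of this kind (\<open>k_cover_preserves_rectangle\<close>). A cover adds one box, so the rectangle
  can be lost only if there are exactly \<open>n\<close> parts \<open>l\<close> and one of them grows to \<open>l + 1\<close>. Then only \<open>n - 1\<close>
  rows of length \<open>l\<close> remain. During these a low column freezes at height \<open>n\<close> only if its
  height was positive initially, and there are fewer than \<open>l\<close> such columns since all the shorter rows
  have length less than \<open>l\<close>. So the number of columns of height at least \<open>n\<close> drops, which contradicts the
  containment of the \<open>k\<close>-conjugates.
\<close>

section \<open>Containment of partitions through counting large parts\<close>

abbreviation nonincreasing :: "nat list \<Rightarrow> bool" where
  "nonincreasing p \<equiv> sorted_wrt (\<ge>) p"

definition parts_ge :: "nat \<Rightarrow> nat list \<Rightarrow> nat" where
  "parts_ge t p = length (filter (\<lambda>x. t \<le> x) p)"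

lemma parts_ge_mset: "parts_ge t p = size (filter_mset (\<lambda>x. t \<le> x) (mset p))"
  by (simp add: parts_ge_def flip: mset_filter)

text \<open>The union of partitions only prescribes a multiset of parts; this turns an identity of multisets
into one of partitions.\<close>

lemma nonincreasing_unique:
  assumes "nonincreasing p" "nonincreasing q" "mset p = mset q"
  shows "p = q"
proof -
  have "sorted (rev p)" "sorted (rev q)" "mset (rev p) = mset (rev q)"
    using assms by (simp_all add: sorted_wrt_rev)
  then have "rev p = rev q"
    by (metis properties_for_sort)
  then show ?thesis by simp
qed

lemma part_Cons: "part (x # p) i = (if i = 1 then x else if i = 0 then 0 else part p (i - 1))"
  by (auto simp: Defs.part_def nth_Cons')

lemma part_in_set: "0 < part p i \<Longrightarrow> part p i \<in> set p"
  by (auto simp: Defs.part_def split: if_splits)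

text \<open>In a nonincreasing list the parts \<open>\<ge> t\<close> form an initial segment. The restriction \<open>1 \<le> t\<close> is
due to the parts equal to 0 beyond the end of the list.\<close>

lemma part_ge_iff:
  assumes "nonincreasing p" "1 \<le> i" "1 \<le> t"
  shows "t \<le> part p i \<longleftrightarrow> i \<le> parts_ge t p"
  using assms
proof (induction p arbitrary: i)
  case Nil
  then show ?case by (simp add: Defs.part_def parts_ge_def)
next
  case (Cons x p)
  show ?case
  proof (cases "t \<le> x")
    case True
    then show ?thesis
      using Cons by (auto simp: part_Cons parts_ge_def)
  next
    case False
    then have "filter (\<lambda>y. t \<le> y) p = []"
      using Cons.prems by (auto simp: filter_empty_conv)
    moreover have "part p (i - 1) < t"
    proof (cases "0 < part p (i - 1)")
      case True
      then show ?thesis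
        using part_in_set[OF True] Cons.prems \<open>\<not> t \<le> x\<close> by auto
    next
      case False
      then show ?thesis
        using Cons.prems by simp
    qed
    ultimately show ?thesis
      using False Cons.prems by (auto simp: part_Cons parts_ge_def)
  qed
qed

text \<open>Containment of diagrams can be tested column by column, and \<open>parts_ge t p\<close> is the height of
column \<open>t\<close>. These numbers depend only on the multiset of parts and are additive under union.\<close>

lemma contained_iff_parts_ge:
  assumes "nonincreasing p" "nonincreasing q"
  shows "contained p q \<longleftrightarrow> (\<forall>t\<ge>1. parts_ge t p \<le> parts_ge t q)"
proof
  assume c: "contained p q"
  show "\<forall>t\<ge>1. parts_ge t p \<le> parts_ge t q"
  proof (intro allI impI)
    fix t :: nat
    assume t: "1 \<le> t"
    show "parts_ge t p \<le> parts_ge t q"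
    proof (cases "parts_ge t p = 0")
      case False
      then have "t \<le> part p (parts_ge t p)"
        using part_ge_iff[OF assms(1) _ t] by simp
      also have "\<dots> \<le> part q (parts_ge t p)"
        using c False by (simp add: contained_def)
      finally show ?thesis
        using part_ge_iff[OF assms(2) _ t] False by simp
    qed simp
  qed
next
  assume n: "\<forall>t\<ge>1. parts_ge t p \<le> parts_ge t q"
  show "contained p q"
    unfolding contained_def
  proof (intro allI impI)
    fix i :: nat
    assume i: "1 \<le> i"
    show "part p i \<le> part q i"
    proof (cases "part p i = 0")
      case False
      then have "i \<le> parts_ge (part p i) p"
        using part_ge_iff[OF assms(1) i, of "part p i"] by simp
      also have "\<dots> \<le> parts_ge (part p i) q"
        using n False by simp
      finally show ?thesis
        using part_ge_iff[OF assms(2) i, of "part p i"] False by simp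
    qed simp
  qed
qed

lemma parts_ge_Suc: "parts_ge t p = parts_ge (Suc t) p + count (mset p) t"
  by (induction p) (auto simp: parts_ge_def)

lemma sum_list_eq_sum_parts_ge:
  assumes "\<forall>x\<in>set p. x \<le> M"
  shows "sum_list p = (\<Sum>t=1..M. parts_ge t p)"
  using assms
proof (induction p)
  case Nil
  then show ?case by (simp add: parts_ge_def)
next
  case (Cons x p)
  have "(\<Sum>t=1..M. parts_ge t (x # p)) = (\<Sum>t=1..M. (if t \<le> x then 1 else 0) + parts_ge t p)"
    by (rule sum.cong) (auto simp: parts_ge_def)
  also have "\<dots> = (\<Sum>t=1..M. if t \<le> x then 1 else 0) + (\<Sum>t=1..M. parts_ge t p)"
    by (rule sum.distrib)
  also have "(\<Sum>t=1..M. if t \<le> x then 1 else 0) = card {t \<in> {1..M}. t \<le> x}"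
    by (simp add: sum.If_cases Int_def)
  also have "{t \<in> {1..M}. t \<le> x} = {1..x}"
    using Cons.prems by auto
  finally show ?case
    using Cons by simp
qed

text \<open>The size of a partition is the sum of its column heights, so these agree except in the column
\<open>t\<close> that contains the additional box: a part \<open>t - 1\<close> has become \<open>t\<close>.\<close>

lemma one_box_added:
  assumes le: "\<forall>t\<ge>1. parts_ge t p \<le> parts_ge t q"
    and sum: "sum_list q = sum_list p + 1"
  obtains t where "1 \<le> t" "parts_ge t q = parts_ge t p + 1"
    "\<And>s. 1 \<le> s \<Longrightarrow> s \<noteq> t \<Longrightarrow> parts_ge s q = parts_ge s p"
proof -
  define M where "M = Max (set (0 # p @ q))"
  have bp: "\<forall>x\<in>set p. x \<le> M" and bq: "\<forall>x\<in>set q. x \<le> M"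
    by (simp_all add: M_def)
  have "(\<Sum>t=1..M. parts_ge t q - parts_ge t p) = (\<Sum>t=1..M. parts_ge t q) - (\<Sum>t=1..M. parts_ge t p)"
    using le by (intro sum_subtractf_nat) auto
  also have "\<dots> = 1"
    using sum sum_list_eq_sum_parts_ge[OF bp] sum_list_eq_sum_parts_ge[OF bq] by simp
  finally obtain t where t: "t \<in> {1..M}" "parts_ge t q - parts_ge t p = 1"
    and other: "\<forall>s\<in>{1..M}. t \<noteq> s \<longrightarrow> parts_ge s q - parts_ge s p = 0"
    by (subst (asm) sum_eq_1_iff) auto
  have "parts_ge s q = parts_ge s p" if "1 \<le> s" "s \<noteq> t" for s
  proof (cases "s \<le> M")
    case True
    then have "parts_ge s q - parts_ge s p = 0"
      using other that by auto
    then show ?thesis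
      using le that by (metis diff_is_0_eq le_antisym)
  next
    case False
    then have "filter (\<lambda>x. s \<le> x) p = []" "filter (\<lambda>x. s \<le> x) q = []"
      using bp bq by (fastforce simp: filter_empty_conv)+
    then show ?thesis
      by (simp add: parts_ge_def)
  qed
  then show ?thesis
    using that[of t] t by auto
qed

lemma k_bounded_partitions_iff:
  "p \<in> k_bounded_partitions k \<longleftrightarrow> nonincreasing p \<and> (\<forall>x\<in>set p. 0 < x \<and> x \<le> k)"
proof -
  have "part p 1 \<le> k \<longleftrightarrow> (\<forall>x\<in>set p. x \<le> k)" if "nonincreasing p"
    using that by (cases p) (auto simp: Defs.part_def)
  then show ?thesis
    by (auto simp: k_bounded_partitions_def is_partition_def)
qed

lemma k_bounded_partitions_Cons:
  "a # p \<in> k_bounded_partitions k \<longleftrightarrow>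
     p \<in> k_bounded_partitions k \<and> 0 < a \<and> a \<le> k \<and> (\<forall>x\<in>set p. x \<le> a)"
  by (auto simp: k_bounded_partitions_iff)

section \<open>The columns of the k-skew diagram, row by row\<close>

text \<open>The effect on the column heights of a row of length \<open>a\<close> inserted below the diagram: columns higher
than \<open>k - a\<close> are skipped, the others are raised, and the remaining cells of the row start new columns.
The truncated subtraction in the last term is harmless for \<open>k\<close>-bounded partitions, because
\<open>short_columns_bound\<close> leaves at most \<open>a\<close> columns to be raised.\<close>

definition add_row :: "nat \<Rightarrow> nat \<Rightarrow> nat list \<Rightarrow> nat list" where
  "add_row k a L = filter (\<lambda>x. k - a < x) L @ map Suc (filter (\<lambda>x. x \<le> k - a) L)
     @ replicate (a - length (filter (\<lambda>x. x \<le> k - a) L)) 1"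

definition columns :: "nat \<Rightarrow> nat list \<Rightarrow> nat list" where
  "columns k p = foldr (add_row k) p []"

lemma columns_simps [simp]:
  "columns k [] = []"
  "columns k (a # p) = add_row k a (columns k p)"
  by (simp_all add: columns_def)

lemma mset_add_row:
  "mset (add_row k a L) = filter_mset (\<lambda>x. k - a < x) (mset L)
     + image_mset Suc (filter_mset (\<lambda>x. x \<le> k - a) (mset L))
     + replicate_mset (a - size (filter_mset (\<lambda>x. x \<le> k - a) (mset L))) 1"
  by (simp add: add_row_def flip: mset_filter)

lemma nonincreasing_replicate: "nonincreasing (replicate m x)"
  by (induction m) auto

lemma nonincreasing_add_row: "nonincreasing L \<Longrightarrow> nonincreasing (add_row k a L)"
  by (auto simp: add_row_def sorted_wrt_append sorted_wrt_map sorted_wrt_filter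
      nonincreasing_replicate)

lemma nonincreasing_columns: "nonincreasing (columns k p)"
  by (induction p) (auto intro: nonincreasing_add_row)

lemma columns_pos: "x \<in> set (columns k p) \<Longrightarrow> 0 < x"
  by (induction p arbitrary: x) (auto simp: add_row_def)

text \<open>If the bottom row has length \<open>a\<close>, then every column of height at most \<open>k - a\<close> meets that
row: the columns it skips are higher than \<open>k - a\<close>, and all columns to the right of these have been
raised or started by it.\<close>

lemma short_columns_bound:
  assumes "p \<in> k_bounded_partitions k" "part p 1 \<le> b"
  shows "length (filter (\<lambda>x. x \<le> k - b) (columns k p)) \<le> part p 1"
  using assms
proof (induction p arbitrary: b)
  case Nil
  then show ?case by simp
next
  case (Cons a p)
  let ?S = "filter (\<lambda>x. x \<le> k - a) (columns k p)"
  have ab: "a \<le> b" using Cons.prems by (simp add: part_Cons)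
  have p: "p \<in> k_bounded_partitions k" "\<forall>x\<in>set p. x \<le> a"
    using Cons.prems by (simp_all add: k_bounded_partitions_Cons)
  then have "part p 1 \<le> a"
    using part_in_set[of p 1] by (cases "part p 1 = 0") auto
  then have "length ?S \<le> a"
    using Cons.IH[OF p(1), of a] by simp
  moreover have "filter (\<lambda>x. x \<le> k - b) (filter (\<lambda>x. k - a < x) (columns k p)) = []"
    using ab by (auto simp: filter_empty_conv)
  then have "length (filter (\<lambda>x. x \<le> k - b) (columns k (a # p)))
      \<le> length (map Suc ?S @ replicate (a - length ?S) 1)"
    unfolding columns_simps add_row_def filter_append
    by (metis append_Nil filter_append length_filter_le)
  ultimately show ?case
    by (simp add: part_Cons)
qed

section \<open>Hook-lengths and columns of a skew diagram\<close>

definition column_height :: "nat list \<Rightarrow> nat list \<Rightarrow> nat \<Rightarrow> nat" where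
  "column_height \<gamma> \<rho> j = card {i. (i, j) \<in> skew_diagram \<gamma> \<rho>}"

lemma part_tl: "1 \<le> i \<Longrightarrow> part (tl p) i = part p (Suc i)"
  by (cases p) (auto simp: Defs.part_def)

lemma part_0 [simp]: "part p 0 = 0"
  by (simp add: Defs.part_def)

lemma skew_diagram_Suc:
  "(Suc i, j) \<in> skew_diagram \<gamma> \<rho> \<longleftrightarrow>
     (if i = 0 then part \<rho> 1 < j \<and> j \<le> part \<gamma> 1 else (i, j) \<in> skew_diagram (tl \<gamma>) (tl \<rho>))"
  by (auto simp: skew_diagram_def part_tl)

lemma skew_diagram_0 [simp]: "(0, j) \<notin> skew_diagram \<gamma> \<rho>"
  by (simp add: skew_diagram_def)

lemma finite_skew_diagram: "finite (skew_diagram \<gamma> \<rho>)"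
proof (rule finite_subset)
  show "skew_diagram \<gamma> \<rho> \<subseteq> (SIGMA i:{..length \<gamma>}. {..part \<gamma> i})"
    by (auto simp: skew_diagram_def Defs.part_def split: if_splits)
qed simp

lemma finite_column: "finite {i. (i, j) \<in> skew_diagram \<gamma> \<rho>}"
  by (rule finite_subset[OF _ finite_imageI[OF finite_skew_diagram, of fst]]) force

text \<open>Row 1 is the lowest row and the head of the list, so taking the tails of both partitions removes the
bottom row of the skew diagram and shifts the others down. Hooks of cells above the bottom row
do not see it, and hooks in the bottom row are determined by the column heights above it.\<close>

lemma column_height_tl:
  "column_height \<gamma> \<rho> j =
     (if part \<rho> 1 < j \<and> j \<le> part \<gamma> 1 then 1 else 0) + column_height (tl \<gamma>) (tl \<rho>) j"
proof -
  let ?S = "{i. (i, j) \<in> skew_diagram (tl \<gamma>) (tl \<rho>)}"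
  let ?T = "if part \<rho> 1 < j \<and> j \<le> part \<gamma> 1 then {1::nat} else {}"
  have "{i. (i, j) \<in> skew_diagram \<gamma> \<rho>} = ?T \<union> Suc ` ?S"
  proof (rule set_eqI)
    fix i
    show "i \<in> {i. (i, j) \<in> skew_diagram \<gamma> \<rho>} \<longleftrightarrow> i \<in> ?T \<union> Suc ` ?S"
      by (cases i) (auto simp: skew_diagram_Suc)
  qed
  moreover have "?T \<inter> Suc ` ?S = {}"
    by auto
  ultimately have "column_height \<gamma> \<rho> j = card ?T + card (Suc ` ?S)"
    unfolding column_height_def using finite_column by (simp add: card_Un_disjoint)
  then show ?thesis
    by (simp add: card_image column_height_def)
qed

lemma hook_length_Suc:
  assumes "1 \<le> i"
  shows "hook_length \<gamma> \<rho> (Suc i) j = hook_length (tl \<gamma>) (tl \<rho>) i j"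
proof -
  let ?H = "{(i', j') \<in> skew_diagram (tl \<gamma>) (tl \<rho>). (i' = i \<and> j \<le> j') \<or> (i \<le> i' \<and> j' = j)}"
  have "{(i', j') \<in> skew_diagram \<gamma> \<rho>. (i' = Suc i \<and> j \<le> j') \<or> (Suc i \<le> i' \<and> j' = j)}
      = map_prod Suc id ` ?H" (is "?G = _")
  proof (rule set_eqI)
    fix c :: "nat \<times> nat"
    obtain i' j' where c: "c = (i', j')" by force
    show "c \<in> ?G \<longleftrightarrow> c \<in> map_prod Suc id ` ?H"
      using assms unfolding c by (cases i') (auto simp: skew_diagram_Suc image_iff)
  qed
  then show ?thesis
    unfolding hook_length_def
    by (simp add: card_image inj_on_def split: prod.splits)
qed

lemma hook_length_1:
  assumes "1 \<le> j"
  shows "hook_length \<gamma> \<rho> 1 j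
     = (part \<gamma> 1 - max (j - 1) (part \<rho> 1)) + column_height (tl \<gamma>) (tl \<rho>) j"
proof -
  let ?R = "{max (j - 1) (part \<rho> 1)<..part \<gamma> 1}"
  let ?C = "{i. (i, j) \<in> skew_diagram (tl \<gamma>) (tl \<rho>)}"
  have "{(i', j') \<in> skew_diagram \<gamma> \<rho>. (i' = 1 \<and> j \<le> j') \<or> (1 \<le> i' \<and> j' = j)}
      = Pair 1 ` ?R \<union> (\<lambda>i. (Suc i, j)) ` ?C" (is "?G = ?A \<union> ?B")
  proof (rule set_eqI)
    fix c :: "nat \<times> nat"
    obtain i' j' where c: "c = (i', j')" by force
    show "c \<in> ?G \<longleftrightarrow> c \<in> ?A \<union> ?B"
      using assms unfolding c by (cases i') (auto simp: skew_diagram_Suc image_iff)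
  qed
  moreover have "?A \<inter> ?B = {}"
    by auto
  ultimately have "hook_length \<gamma> \<rho> 1 j = card ?A + card ?B"
    unfolding hook_length_def using finite_column by (simp add: card_Un_disjoint)
  then show ?thesis
    by (simp add: card_image inj_on_def column_height_def)
qed

lemma card_skew_row: "1 \<le> i \<Longrightarrow> card {j. (i, j) \<in> skew_diagram \<gamma> \<rho>} = part \<gamma> i - part \<rho> i"
proof -
  assume "1 \<le> i"
  then have "{j. (i, j) \<in> skew_diagram \<gamma> \<rho>} = {part \<rho> i<..part \<gamma> i}"
    by (auto simp: skew_diagram_def)
  then show ?thesis by simp
qed

lemma is_partition_tl: "is_partition p \<Longrightarrow> is_partition (tl p)"
  by (cases p) (auto simp: is_partition_def)

lemma all_ge_1_iff: "(\<forall>i\<ge>1. P i) \<longleftrightarrow> P (1::nat) \<and> (\<forall>i\<ge>1. P (Suc i))"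
  by (metis One_nat_def Suc_le_mono le_SucE le_SucI not0_implies_Suc not_one_le_zero zero_le)

text \<open>A \<open>k\<close>-skew diagram is therefore a \<open>k\<close>-skew diagram of the remaining rows together with a condition on
the bottom row alone, which makes an induction over the rows possible.\<close>

lemma is_k_skew_Cons:
  "is_k_skew k (a # p) \<gamma> \<rho> \<longleftrightarrow>
     is_partition \<gamma> \<and> is_partition \<rho> \<and> part \<gamma> 1 = part \<rho> 1 + a \<and> is_k_skew k p (tl \<gamma>) (tl \<rho>) \<and>
     (\<forall>j. part \<rho> 1 < j \<and> j \<le> part \<gamma> 1 \<longrightarrow> hook_length \<gamma> \<rho> 1 j \<le> k) \<and>
     (\<forall>j. 1 \<le> j \<and> j \<le> part \<rho> 1 \<longrightarrow> k < hook_length \<gamma> \<rho> 1 j)"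
proof -
  have c: "contained \<rho> \<gamma> \<longleftrightarrow> part \<rho> 1 \<le> part \<gamma> 1 \<and> contained (tl \<rho>) (tl \<gamma>)"
    unfolding contained_def by (subst all_ge_1_iff) (simp add: part_tl)
  have r: "(\<forall>i\<ge>1. card {j. (i, j) \<in> skew_diagram \<gamma> \<rho>} = part (a # p) i) \<longleftrightarrow>
      part \<gamma> 1 - part \<rho> 1 = a \<and>
      (\<forall>i\<ge>1. card {j. (i, j) \<in> skew_diagram (tl \<gamma>) (tl \<rho>)} = part p i)"
    by (subst all_ge_1_iff) (auto simp: card_skew_row part_Cons part_tl)
  have h: "(\<forall>(i, j)\<in>skew_diagram \<gamma> \<rho>. hook_length \<gamma> \<rho> i j \<le> k) \<longleftrightarrow>
      (\<forall>j. part \<rho> 1 < j \<and> j \<le> part \<gamma> 1 \<longrightarrow> hook_length \<gamma> \<rho> 1 j \<le> k) \<and>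
      (\<forall>(i, j)\<in>skew_diagram (tl \<gamma>) (tl \<rho>). hook_length (tl \<gamma>) (tl \<rho>) i j \<le> k)"
  proof -
    have "(\<forall>(i, j)\<in>skew_diagram \<gamma> \<rho>. hook_length \<gamma> \<rho> i j \<le> k) \<longleftrightarrow>
        (\<forall>i\<ge>1. \<forall>j. (i, j) \<in> skew_diagram \<gamma> \<rho> \<longrightarrow> hook_length \<gamma> \<rho> i j \<le> k)"
      by (auto simp: skew_diagram_def)
    also have "\<dots> \<longleftrightarrow>
      (\<forall>j. part \<rho> 1 < j \<and> j \<le> part \<gamma> 1 \<longrightarrow> hook_length \<gamma> \<rho> 1 j \<le> k) \<and>
      (\<forall>i\<ge>1. \<forall>j. (i, j) \<in> skew_diagram (tl \<gamma>) (tl \<rho>) \<longrightarrow> hook_length (tl \<gamma>) (tl \<rho>) i j \<le> k)"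
      by (subst all_ge_1_iff) (simp add: hook_length_Suc skew_diagram_Suc[of 0, simplified] skew_diagram_Suc)
    also have "(\<forall>i\<ge>1. \<forall>j. (i, j) \<in> skew_diagram (tl \<gamma>) (tl \<rho>) \<longrightarrow> hook_length (tl \<gamma>) (tl \<rho>) i j \<le> k)
        \<longleftrightarrow> (\<forall>(i, j)\<in>skew_diagram (tl \<gamma>) (tl \<rho>). hook_length (tl \<gamma>) (tl \<rho>) i j \<le> k)"
      by (auto simp: skew_diagram_def)
    finally show ?thesis .
  qed
  have b: "(\<forall>(i, j)\<in>diagram \<rho>. k < hook_length \<gamma> \<rho> i j) \<longleftrightarrow>
      (\<forall>j. 1 \<le> j \<and> j \<le> part \<rho> 1 \<longrightarrow> k < hook_length \<gamma> \<rho> 1 j) \<and>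
      (\<forall>(i, j)\<in>diagram (tl \<rho>). k < hook_length (tl \<gamma>) (tl \<rho>) i j)"
  proof -
    have "(\<forall>(i, j)\<in>diagram \<rho>. k < hook_length \<gamma> \<rho> i j) \<longleftrightarrow>
        (\<forall>i\<ge>1. \<forall>j. 1 \<le> j \<and> j \<le> part \<rho> i \<longrightarrow> k < hook_length \<gamma> \<rho> i j)"
      by (auto simp: diagram_def)
    also have "\<dots> \<longleftrightarrow>
      (\<forall>j. 1 \<le> j \<and> j \<le> part \<rho> 1 \<longrightarrow> k < hook_length \<gamma> \<rho> 1 j) \<and>
      (\<forall>i\<ge>1. \<forall>j. 1 \<le> j \<and> j \<le> part (tl \<rho>) i \<longrightarrow> k < hook_length (tl \<gamma>) (tl \<rho>) i j)"
      by (subst all_ge_1_iff) (simp add: hook_length_Suc part_tl)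
    also have "(\<forall>i\<ge>1. \<forall>j. 1 \<le> j \<and> j \<le> part (tl \<rho>) i \<longrightarrow> k < hook_length (tl \<gamma>) (tl \<rho>) i j)
        \<longleftrightarrow> (\<forall>(i, j)\<in>diagram (tl \<rho>). k < hook_length (tl \<gamma>) (tl \<rho>) i j)"
      by (auto simp: diagram_def)
    finally show ?thesis .
  qed
  show ?thesis
    unfolding is_k_skew_def c r h b using is_partition_tl by auto
qed

lemma part_1_eq_0_iff: "is_partition p \<Longrightarrow> part p 1 = 0 \<longleftrightarrow> p = []"
  by (cases p) (auto simp: Defs.part_def is_partition_def)

text \<open>Without cells every hook-length is 0, so no square can lie below the diagram.\<close>

lemma is_k_skew_Nil: "is_k_skew k [] \<gamma> \<rho> \<longleftrightarrow> \<gamma> = [] \<and> \<rho> = []"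
proof
  assume s: "is_k_skew k [] \<gamma> \<rho>"
  then have rows: "part \<gamma> i - part \<rho> i = 0" if "1 \<le> i" for i
    using that card_skew_row[OF that, of \<gamma> \<rho>] by (auto simp: is_k_skew_def Defs.part_def)
  then have empty: "skew_diagram \<gamma> \<rho> = {}"
    by (force simp: skew_diagram_def)
  have "(1, 1) \<notin> diagram \<rho>"
    using s by (force simp: is_k_skew_def hook_length_def empty)
  then have \<rho>: "\<rho> = []"
    using s part_1_eq_0_iff[of \<rho>] by (auto simp: diagram_def is_k_skew_def)
  then have "part \<gamma> 1 = 0"
    using rows[of 1] by (simp add: Defs.part_def)
  then show "\<gamma> = [] \<and> \<rho> = []"
    using \<rho> s part_1_eq_0_iff[of \<gamma>] by (simp add: is_k_skew_def)
next
  assume "\<gamma> = [] \<and> \<rho> = []"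
  then show "is_k_skew k [] \<gamma> \<rho>"
    by (auto simp: is_k_skew_def is_partition_def contained_def skew_diagram_def diagram_def Defs.part_def)
qed

definition column_list :: "nat list \<Rightarrow> nat list \<Rightarrow> nat list" where
  "column_list \<gamma> \<rho> = map (column_height \<gamma> \<rho>) [1..<part \<gamma> 1 + 1]"

lemma is_partition_Cons: "is_partition (x # p) \<longleftrightarrow> is_partition p \<and> 0 < x \<and> part p 1 \<le> x"
  by (cases p) (auto simp: is_partition_def Defs.part_def)

lemma part_antimono_1: "is_partition p \<Longrightarrow> part p i \<le> part p 1"
  by (cases p) (auto simp: Defs.part_def is_partition_def nth_Cons split: nat.splits)

lemma part_column_list:
  assumes "is_partition \<gamma>" "1 \<le> j"
  shows "part (column_list \<gamma> \<rho>) j = column_height \<gamma> \<rho> j"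
proof (cases "j \<le> part \<gamma> 1")
  case True
  then show ?thesis
    using assms by (simp add: column_list_def Defs.part_def[of "map _ _"] del: upt_Suc)
next
  case False
  have "{i. (i, j) \<in> skew_diagram \<gamma> \<rho>} = {}"
    using False part_antimono_1[OF assms(1)] by (auto simp: skew_diagram_def dest: le_trans)
  then show ?thesis
    using False by (simp add: column_list_def column_height_def Defs.part_def[of "map _ _"] del: upt_Suc)
qed

lemma mset_split_at: "filter_mset (\<lambda>x::nat. c < x) M + filter_mset (\<lambda>x. x \<le> c) M = M"
  using multiset_partition[of M "\<lambda>x. c < x"] by (simp add: not_less)

text \<open>The columns skipped by a new row are the first ones, so listing the skipped columns before the raised
ones keeps the columns in their order from left to right.\<close>

lemma filter_nonincreasing:
  assumes "nonincreasing L"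
  shows "filter (\<lambda>x. c < x) L = take (parts_ge (Suc c) L) L"
    and "filter (\<lambda>x. x \<le> c) L = drop (parts_ge (Suc c) L) L"
proof -
  have "L = filter (\<lambda>x. c < x) L @ filter (\<lambda>x. x \<le> c) L" (is "_ = ?M")
  proof (rule nonincreasing_unique[OF assms])
    show "nonincreasing ?M"
      using assms by (auto simp: sorted_wrt_append sorted_wrt_filter)
    show "mset L = mset ?M"
      by (simp add: mset_split_at)
  qed
  moreover have "parts_ge (Suc c) L = length (filter (\<lambda>x. c < x) L)"
    by (simp add: parts_ge_def Suc_le_eq)
  ultimately show "filter (\<lambda>x. c < x) L = take (parts_ge (Suc c) L) L"
    "filter (\<lambda>x. x \<le> c) L = drop (parts_ge (Suc c) L) L"
    by (metis append_eq_conv_conj)+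
qed

text \<open>In the induction step let \<open>h\<close> be the number of columns higher than \<open>k - a\<close> in the diagram of the other
rows. If the bottom row began at one of the first \<open>h\<close> columns, the hook of its first cell would
exceed \<open>k\<close>; if it began to the right of column \<open>h + 1\<close>, the square just before it would have a hook of
at most \<open>k\<close>. So it must occupy the columns \<open>h + 1, \<dots>, h + a\<close>.\<close>

lemma is_k_skew_unique_columns:
  assumes "p \<in> k_bounded_partitions k"
  shows "\<exists>\<gamma> \<rho>. (\<forall>\<gamma>' \<rho>'. is_k_skew k p \<gamma>' \<rho>' \<longleftrightarrow> \<gamma>' = \<gamma> \<and> \<rho>' = \<rho>) \<and> column_list \<gamma> \<rho> = columns k p"
  using assms
proof (induction p)
  case Nil
  show ?case
    by (rule exI[of _ "[]"], rule exI[of _ "[]"]) (simp add: is_k_skew_Nil column_list_def Defs.part_def)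
next
  case (Cons a p)
  have p: "p \<in> k_bounded_partitions k" and a: "0 < a" "a \<le> k" and pa: "\<forall>x\<in>set p. x \<le> a"
    using Cons.prems by (simp_all add: k_bounded_partitions_Cons)
  obtain \<gamma> \<rho> where uniq: "\<And>\<gamma>' \<rho>'. is_k_skew k p \<gamma>' \<rho>' \<longleftrightarrow> \<gamma>' = \<gamma> \<and> \<rho>' = \<rho>"
    and cols: "column_list \<gamma> \<rho> = columns k p"
    using Cons.IH[OF p] by blast
  have skew: "is_k_skew k p \<gamma> \<rho>"
    by (simp add: uniq)
  then have parts: "is_partition \<gamma>" "is_partition \<rho>"
    by (simp_all add: is_k_skew_def)
  define L where "L = columns k p"
  define h where "h = parts_ge (Suc (k - a)) L"
  have L: "nonincreasing L"
    by (simp add: L_def nonincreasing_columns)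
  have lenL: "length L = part \<gamma> 1"
    by (simp add: L_def column_list_def flip: cols)
  have height: "column_height \<gamma> \<rho> j = part L j" if "1 \<le> j" for j
    using part_column_list[OF parts(1) that, of \<rho>] by (simp add: L_def cols)
  \<comment> \<open>The columns decrease in height from left to right, so the first \<open>h\<close> are the high ones.\<close>
  have high: "k - a < column_height \<gamma> \<rho> j \<longleftrightarrow> j \<le> h" if "1 \<le> j" for j
    using part_ge_iff[OF L that, of "Suc (k - a)"] by (simp add: height[OF that] h_def Suc_le_eq)
  have "part p 1 \<le> a"
    using pa part_in_set[of p 1] by (cases "part p 1 = 0") auto
  then have low: "length (filter (\<lambda>x. x \<le> k - a) L) \<le> part p 1"
    unfolding L_def by (intro short_columns_bound[OF p])
  have "h + length (filter (\<lambda>x. x \<le> k - a) L) = part \<gamma> 1"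
    using sum_length_filter_compl[of "\<lambda>x. x \<le> k - a" L]
    by (simp add: h_def parts_ge_def lenL not_le Suc_le_eq)
  moreover have "part \<gamma> 1 = part \<rho> 1 + part p 1"
    using skew card_skew_row[of 1 \<gamma> \<rho>] by (force simp: is_k_skew_def contained_def)
  \<comment> \<open>With these bounds, placing the row in columns \<open>h + 1, \<dots>, h + a\<close> gives partitions again.\<close>
  ultimately have h\<rho>: "part \<rho> 1 \<le> h" and h\<gamma>: "part \<gamma> 1 \<le> h + a" and h_le: "h \<le> part \<gamma> 1"
    using low \<open>part p 1 \<le> a\<close> by linarith+
  define \<gamma>2 where "\<gamma>2 = (h + a) # \<gamma>"
  \<comment> \<open>A list of positive parts cannot hold the entry \<open>h\<close> if it is 0.\<close>
  define \<rho>2 where "\<rho>2 = (if h = 0 then [] else h # \<rho>)"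
  have \<rho>0: "\<rho> = []" if "h = 0"
    using h\<rho> that part_1_eq_0_iff[OF parts(2)] by simp
  have tl2: "tl \<gamma>2 = \<gamma>" "tl \<rho>2 = \<rho>"
    using \<rho>0 by (auto simp: \<gamma>2_def \<rho>2_def)
  have part2: "part \<gamma>2 1 = h + a" "part \<rho>2 1 = h"
    by (auto simp: \<gamma>2_def \<rho>2_def Defs.part_def)
  have "is_k_skew k (a # p) \<gamma>' \<rho>' \<longleftrightarrow> \<gamma>' = \<gamma>2 \<and> \<rho>' = \<rho>2" for \<gamma>' \<rho>'
  proof
    assume "is_k_skew k (a # p) \<gamma>' \<rho>'"
    then have s: "is_partition \<gamma>'" "is_partition \<rho>'" "part \<gamma>' 1 = part \<rho>' 1 + a"
      "tl \<gamma>' = \<gamma>" "tl \<rho>' = \<rho>"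
      and inside: "\<And>j. part \<rho>' 1 < j \<Longrightarrow> j \<le> part \<gamma>' 1 \<Longrightarrow> hook_length \<gamma>' \<rho>' 1 j \<le> k"
      and below: "\<And>j. 1 \<le> j \<Longrightarrow> j \<le> part \<rho>' 1 \<Longrightarrow> k < hook_length \<gamma>' \<rho>' 1 j"
      unfolding is_k_skew_Cons uniq by auto
    have "part \<rho>' 1 = h"
    proof (rule antisym)
      show "part \<rho>' 1 \<le> h"
      proof (cases "part \<rho>' 1 = 0")
        case False
        then have "k < a + column_height \<gamma> \<rho> (part \<rho>' 1)"
          using below[of "part \<rho>' 1"] hook_length_1[of "part \<rho>' 1" \<gamma>' \<rho>'] s by (simp add: max_def)
        then have "k - a < column_height \<gamma> \<rho> (part \<rho>' 1)"
          using a by linarith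
        then show ?thesis
          using high[of "part \<rho>' 1"] False by simp
      qed simp
      have "a + column_height \<gamma> \<rho> (Suc (part \<rho>' 1)) \<le> k"
        using inside[of "Suc (part \<rho>' 1)"] hook_length_1[of "Suc (part \<rho>' 1)" \<gamma>' \<rho>'] s a
        by (simp add: max_def)
      then have "\<not> k - a < column_height \<gamma> \<rho> (Suc (part \<rho>' 1))"
        by linarith
      then show "h \<le> part \<rho>' 1"
        using high[of "Suc (part \<rho>' 1)"] by simp
    qed
    moreover have "\<gamma>' \<noteq> []"
      using s(3) a by (auto simp: Defs.part_def)
    then have "\<gamma>' = part \<gamma>' 1 # tl \<gamma>'"
      by (cases \<gamma>') (simp_all add: Defs.part_def)
    moreover have "\<rho>' = part \<rho>' 1 # tl \<rho>'" if "h \<noteq> 0"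
      using that \<open>part \<rho>' 1 = h\<close> by (cases \<rho>') (simp_all add: Defs.part_def)
    moreover have "\<rho>' = []" if "h = 0"
      using that \<open>part \<rho>' 1 = h\<close> part_1_eq_0_iff[OF s(2)] by simp
    ultimately show "\<gamma>' = \<gamma>2 \<and> \<rho>' = \<rho>2"
      unfolding \<gamma>2_def \<rho>2_def using s by (metis (full_types))
  next
    assume eq: "\<gamma>' = \<gamma>2 \<and> \<rho>' = \<rho>2"
    have "is_partition \<gamma>2" "is_partition \<rho>2"
      using parts h\<gamma> h\<rho> a by (auto simp: \<gamma>2_def \<rho>2_def is_partition_Cons) (simp add: is_partition_def)
    moreover have "hook_length \<gamma>2 \<rho>2 1 j \<le> k" if "h < j" "j \<le> h + a" for j
    proof -
      have "column_height \<gamma> \<rho> j \<le> k - a"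
        using high[of j] that by (simp add: not_less[symmetric])
      moreover have "max (j - 1) h = j - 1"
        using that by simp
      then have "hook_length \<gamma>2 \<rho>2 1 j = (h + a - (j - 1)) + column_height \<gamma> \<rho> j"
        using hook_length_1[of j \<gamma>2 \<rho>2] that by (simp add: part2[simplified] tl2)
      ultimately show ?thesis
        using that a by linarith
    qed
    moreover have "k < hook_length \<gamma>2 \<rho>2 1 j" if "1 \<le> j" "j \<le> h" for j
    proof -
      have "max (j - 1) h = h"
        using that by simp
      then have "hook_length \<gamma>2 \<rho>2 1 j = a + column_height \<gamma> \<rho> j"
        using hook_length_1[of j \<gamma>2 \<rho>2] that by (simp add: part2[simplified] tl2)
      then show ?thesis
        using high[of j] that a by linarith
    qed
    ultimately show "is_k_skew k (a # p) \<gamma>' \<rho>'"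
      by (simp add: eq is_k_skew_Cons part2[simplified] tl2 skew)
  qed
  moreover have "column_list \<gamma>2 \<rho>2 = columns k (a # p)"
  proof (rule nth_equalityI)
    have split: "add_row k a L = take h L @ map Suc (drop h L) @ replicate (h + a - length L) 1"
      unfolding add_row_def filter_nonincreasing[OF L] h_def[symmetric]
      using h_le by (simp add: lenL)
    show len: "length (column_list \<gamma>2 \<rho>2) = length (columns k (a # p))"
      using h_le h\<gamma> a by (simp add: column_list_def part2[simplified] split lenL flip: L_def)
    fix i
    assume "i < length (column_list \<gamma>2 \<rho>2)"
    then have i: "i < h + a"
      by (simp add: column_list_def part2[simplified] del: upt_Suc)
    have "column_list \<gamma>2 \<rho>2 ! i = column_height \<gamma>2 \<rho>2 (Suc i)"
      using i by (simp add: column_list_def part2[simplified] del: upt_Suc)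
    also have "\<dots> = (if h \<le> i then 1 else 0) + part L (Suc i)"
      using i column_height_tl[of \<gamma>2 \<rho>2 "Suc i"] height[of "Suc i"]
      by (simp add: part2[simplified] tl2 less_Suc_eq_le Suc_le_eq)
    also have "\<dots> = add_row k a L ! i"
      using i h_le h\<gamma> unfolding split by (auto simp: nth_append Defs.part_def lenL)
    finally show "column_list \<gamma>2 \<rho>2 ! i = columns k (a # p) ! i"
      by (simp add: L_def)
  qed
  ultimately show ?case
    by blast
qed

theorem k_conjugate_eq_columns:
  assumes "p \<in> k_bounded_partitions k"
  shows "k_conjugate k p = columns k p"
proof -
  obtain \<gamma> \<rho> where uniq: "\<forall>\<gamma>' \<rho>'. is_k_skew k p \<gamma>' \<rho>' \<longleftrightarrow> \<gamma>' = \<gamma> \<and> \<rho>' = \<rho>"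
    and cols: "column_list \<gamma> \<rho> = columns k p"
    using is_k_skew_unique_columns[OF assms] by blast
  have "k_skew k p = (\<gamma>, \<rho>)"
    unfolding k_skew_def by (rule the_equality) (auto simp: uniq)
  then show ?thesis
    by (simp add: k_conjugate_def column_height_def[abs_def] column_list_def flip: cols)
qed

section \<open>Inserting the rows of a rectangle\<close>

text \<open>A step of the rotation of the low columns. On the left all \<open>l\<close> columns have been raised and the columns
frozen earlier are added; on the right the columns that have just reached height \<open>n\<close> are counted among the
frozen ones, and their places are taken by columns of height 0, which are not listed. A height
\<open>d < n\<close> wraps around at most once in \<open>n\<close> steps, so \<open>n \<le> d + j\<close> says that the column that started
at \<open>d\<close> is frozen by step \<open>j\<close>.\<close>

lemma image_mset_rotate:
  assumes "\<And>d. d \<in># D \<Longrightarrow> d < n" "j < n"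
  shows "image_mset (\<lambda>d. Suc ((d + j) mod n)) D + replicate_mset (size {#d \<in># D. n \<le> d + j#}) n
       = replicate_mset (size {#d \<in># D. n \<le> d + Suc j#}) n
         + filter_mset (\<lambda>d. 0 < d) (image_mset (\<lambda>d. (d + Suc j) mod n) D)"
  using assms(1)
proof (induction D)
  case empty
  then show ?case by simp
next
  case (add d D)
  have d: "d < n" using add.prems by simp
  consider "d + Suc j < n" | "d + Suc j = n" | "n \<le> d + j" "d + j < n + n" "d + Suc j < n + n"
    using d assms(2) by linarith
  then show ?case
  proof cases
    case 1
    then show ?thesis using add by simp
  next
    case 2
    then have "Suc ((d + j) mod n) = n" "(d + Suc j) mod n = 0" "\<not> n \<le> d + j" "n \<le> d + Suc j"
      by (auto simp: mod_less)
    then show ?thesis using add by simp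
  next
    case 3
    then have "(d + j) mod n = d + j - n" "(d + Suc j) mod n = d + Suc j - n"
      by (simp_all add: le_mod_geq)
    then have "Suc ((d + j) mod n) = (d + Suc j) mod n" "0 < (d + Suc j) mod n"
      using 3 by simp_all
    then show ?thesis using add 3 by simp
  qed
qed

text \<open>The multiset \<open>D\<close> consists of the heights of the columns lower than \<open>n\<close>, completed by zeros to \<open>l\<close>
columns. After \<open>j\<close> rows of length \<open>l\<close> these heights are rotated by \<open>j\<close>, and each column that has wrapped
around has left behind a column of height \<open>n\<close>.\<close>

lemma columns_rectangle_rows:
  fixes n :: nat
  assumes j: "j \<le> n" and n: "n = Suc (k - l)"
    and D: "\<And>d. d \<in># D \<Longrightarrow> d < n" "size D = l"
    and D0: "filter_mset (\<lambda>d. 0 < d) D = filter_mset (\<lambda>x. x < n) (mset (columns k p))"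
  shows "mset (columns k (replicate j l @ p)) =
           filter_mset (\<lambda>x. n \<le> x) (mset (columns k p))
           + replicate_mset (size {#d \<in># D. n \<le> d + j#}) n
           + filter_mset (\<lambda>d. 0 < d) (image_mset (\<lambda>d. (d + j) mod n) D)"
  using j
proof (induction j)
  case 0
  have "{#d \<in># D. n \<le> d#} = {#}"
    using D(1) by (auto simp: not_le)
  moreover have "image_mset (\<lambda>d. d mod n) D = D"
    using D(1) by (simp cong: image_mset_cong)
  moreover have "mset (columns k p) = filter_mset (\<lambda>x. n \<le> x) (mset (columns k p))
      + filter_mset (\<lambda>x. \<not> n \<le> x) (mset (columns k p))"
    by (rule multiset_partition)
  ultimately show ?case
    by (simp add: D0 not_le del: filter_mset_eq_mempty_iff)
next
  case (Suc j)
  define F where "F = filter_mset (\<lambda>x. n \<le> x) (mset (columns k p))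
    + replicate_mset (size {#d \<in># D. n \<le> d + j#}) n"
  define W where "W = image_mset (\<lambda>d. (d + j) mod n) D"
  let ?P = "filter_mset (\<lambda>d. 0 < d) W"
  have npos: "0 < n" using n by simp
  have F: "\<forall>x\<in>#F. k - l < x"
    using n by (auto simp: F_def)
  have W: "\<forall>x\<in>#W. x \<le> k - l"
    using n npos by (auto simp: W_def less_Suc_eq_le[symmetric])
  have IH: "mset (columns k (replicate j l @ p)) = F + ?P"
    using Suc by (simp add: F_def W_def)
  have hi: "filter_mset (\<lambda>x. k - l < x) (F + ?P) = F"
    and lo: "filter_mset (\<lambda>x. x \<le> k - l) (F + ?P) = ?P"
  proof -
    have "filter_mset (\<lambda>x. k - l < x) F = F" "filter_mset (\<lambda>x. x \<le> k - l) ?P = ?P"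
      using F W by (auto simp: filter_mset_eq_conv)
    moreover have "filter_mset (\<lambda>x. x \<le> k - l) F = {#}" "filter_mset (\<lambda>x. k - l < x) ?P = {#}"
      using F W by (auto simp: not_le not_less)
    ultimately show "filter_mset (\<lambda>x. k - l < x) (F + ?P) = F"
      "filter_mset (\<lambda>x. x \<le> k - l) (F + ?P) = ?P"
      by simp_all
  qed
  \<comment> \<open>The new columns started by the row are the raised zeros of the window.\<close>
  have W_split: "W = ?P + replicate_mset (l - size ?P) 0"
  proof -
    have "W = ?P + filter_mset (\<lambda>d. \<not> 0 < d) W"
      by (rule multiset_partition)
    moreover have "filter_mset (\<lambda>d. \<not> 0 < d) W = replicate_mset (size (filter_mset (\<lambda>d. \<not> 0 < d) W)) 0"
      by (induction W) auto
    moreover have "size W = size ?P + size (filter_mset (\<lambda>d. \<not> 0 < d) W)"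
      by (metis size_union multiset_partition)
    ultimately show ?thesis
      using D(2) by (metis W_def diff_add_inverse size_image_mset)
  qed
  have "mset (columns k (replicate (Suc j) l @ p)) = F + (image_mset Suc ?P + replicate_mset (l - size ?P) 1)"
    unfolding replicate_Suc append_Cons columns_simps mset_add_row IH hi lo
    by (simp add: add.assoc)
  also have "image_mset Suc ?P + replicate_mset (l - size ?P) 1 = image_mset Suc W"
    using arg_cong[OF W_split, of "image_mset Suc"] by simp
  also have "\<dots> = image_mset (\<lambda>d. Suc ((d + j) mod n)) D"
    by (simp add: W_def multiset.map_comp comp_def)
  also have "F + \<dots> = filter_mset (\<lambda>x. n \<le> x) (mset (columns k p)) +
      (image_mset (\<lambda>d. Suc ((d + j) mod n)) D + replicate_mset (size {#d \<in># D. n \<le> d + j#}) n)"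
    by (simp add: F_def)
  also have "\<dots> = filter_mset (\<lambda>x. n \<le> x) (mset (columns k p)) +
      (replicate_mset (size {#d \<in># D. n \<le> d + Suc j#}) n
         + filter_mset (\<lambda>d. 0 < d) (image_mset (\<lambda>d. (d + Suc j) mod n) D))"
    using image_mset_rotate[of D n j] D(1) Suc.prems by simp
  finally show ?case
    by (simp add: add.assoc)
qed

text \<open>The window has room for all low columns because rows of length at most \<open>l\<close> leave at most \<open>l\<close> of
them; the bound by the largest part is kept since it is strict when that part is less than \<open>l\<close>.\<close>

lemma short_columns_window:
  assumes p: "p \<in> k_bounded_partitions k" and pl: "part p 1 \<le> l" and n: "n = Suc (k - l)"
  obtains D where "\<And>d. d \<in># D \<Longrightarrow> d < n" "size D = l"
    "filter_mset (\<lambda>d. 0 < d) D = filter_mset (\<lambda>x. x < n) (mset (columns k p))"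
    "size (filter_mset (\<lambda>d. 0 < d) D) \<le> part p 1"
proof -
  define S where "S = filter_mset (\<lambda>x. x < n) (mset (columns k p))"
  define D where "D = S + replicate_mset (l - size S) 0"
  have "S = mset (filter (\<lambda>x. x \<le> k - l) (columns k p))"
    by (simp add: S_def n less_Suc_eq_le)
  then have size: "size S \<le> part p 1"
    using short_columns_bound[OF p pl] by (simp del: mset_filter)
  have "filter_mset (\<lambda>d. 0 < d) S = S"
    by (auto simp: S_def filter_mset_eq_conv dest: columns_pos)
  then have "filter_mset (\<lambda>d. 0 < d) D = S"
    by (simp add: D_def)
  moreover have "\<And>d. d \<in># D \<Longrightarrow> d < n"
    by (auto simp: D_def S_def n split: if_splits)
  moreover have "size D = l"
    using size pl by (simp add: D_def)
  ultimately show ?thesis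
    using that[of D] size by (simp add: S_def)
qed

text \<open>After \<open>n\<close> steps the rotation is the identity and each of the \<open>l\<close> columns has wrapped around once.\<close>

lemma columns_full_rectangle:
  assumes p: "p \<in> k_bounded_partitions k" and pl: "part p 1 \<le> l" and n: "n = Suc (k - l)"
  shows "mset (columns k (replicate n l @ p)) = mset (columns k p) + replicate_mset l n"
proof -
  obtain D where D: "\<And>d. d \<in># D \<Longrightarrow> d < n" "size D = l"
    "filter_mset (\<lambda>d. 0 < d) D = filter_mset (\<lambda>x. x < n) (mset (columns k p))"
    using short_columns_window[OF p pl n] by blast
  have "image_mset (\<lambda>d. (d + n) mod n) D = D"
    using D(1) by (simp cong: image_mset_cong)
  moreover have "mset (columns k p) = filter_mset (\<lambda>x. n \<le> x) (mset (columns k p))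
      + filter_mset (\<lambda>x. \<not> n \<le> x) (mset (columns k p))"
    by (rule multiset_partition)
  ultimately show ?thesis
    using columns_rectangle_rows[OF order_refl n D] D(2,3)
    by (simp add: not_le ac_simps)
qed

text \<open>After \<open>n - 1\<close> steps the columns that started at height 0 have not yet reached height \<open>n\<close>. Such a column
exists if all rows of \<open>p\<close> are shorter than \<open>l\<close>.\<close>

lemma parts_ge_columns_broken_rectangle:
  assumes p: "p \<in> k_bounded_partitions k" and pl: "part p 1 < l" and n: "n = Suc (k - l)"
  shows "parts_ge n (columns k (replicate (k - l) l @ p)) < parts_ge n (columns k (replicate n l @ p))"
proof -
  obtain D where D: "\<And>d. d \<in># D \<Longrightarrow> d < n" "size D = l"
    "filter_mset (\<lambda>d. 0 < d) D = filter_mset (\<lambda>x. x < n) (mset (columns k p))"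
    and small: "size (filter_mset (\<lambda>d. 0 < d) D) \<le> part p 1"
    using short_columns_window[OF p less_imp_le[OF pl] n] by blast
  let ?F = "filter_mset (\<lambda>x. n \<le> x) (mset (columns k p))"
  have "filter_mset (\<lambda>x. n \<le> x) (filter_mset (\<lambda>d. 0 < d) (image_mset (\<lambda>d. (d + (k - l)) mod n) D)) = {#}"
    using n by (auto simp: not_le)
  moreover have tall: "filter_mset (\<lambda>x. n \<le> x) (replicate_mset m n) = replicate_mset m n" for m
    by (induction m) auto
  moreover have "filter_mset (\<lambda>x. n \<le> x) ?F = ?F"
    by (rule multiset_eqI) auto
  moreover have "mset (columns k (replicate (k - l) l @ p)) = ?F
      + replicate_mset (size {#d \<in># D. n \<le> d + (k - l)#}) n
      + filter_mset (\<lambda>d. 0 < d) (image_mset (\<lambda>d. (d + (k - l)) mod n) D)"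
    using columns_rectangle_rows[OF _ n D, of "k - l"] n by simp
  ultimately have "parts_ge n (columns k (replicate (k - l) l @ p))
      = size ?F + size {#d \<in># D. n \<le> d + (k - l)#}"
    by (simp only: parts_ge_mset filter_union_mset size_union size_replicate_mset size_empty add_0_right)
  also have "{#d \<in># D. n \<le> d + (k - l)#} = filter_mset (\<lambda>d. 0 < d) D"
    using n by (intro filter_mset_cong) auto
  also have "size ?F + size (filter_mset (\<lambda>d. 0 < d) D) < size ?F + l"
    using small pl by simp
  also have "\<dots> = parts_ge n (columns k (replicate n l @ p))"
    using columns_full_rectangle[OF p less_imp_le[OF pl] n] by (simp add: parts_ge_mset tall)
  finally show ?thesis .
qed

text \<open>A row longer than \<open>l\<close> raises columns of height at most \<open>k - l - 1\<close> only, so no column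
reaches height \<open>n\<close> by it.\<close>

lemma parts_ge_columns_long_rows:
  assumes "\<forall>x\<in>set p. l < x \<and> x \<le> k" "n = Suc (k - l)"
  shows "parts_ge n (columns k (p @ q)) = parts_ge n (columns k q)"
  using assms(1)
proof (induction p)
  case Nil
  then show ?case by simp
next
  case (Cons a p)
  let ?L = "columns k (p @ q)"
  have a: "l < a" "a \<le> k" using Cons.prems by simp_all
  have "filter (\<lambda>x. n \<le> x) (filter (\<lambda>x. k - a < x) ?L) = filter (\<lambda>x. n \<le> x) ?L"
    using a assms(2) by (auto intro!: filter_cong)
  moreover have "filter (\<lambda>x. n \<le> x) (map Suc (filter (\<lambda>x. x \<le> k - a) ?L)) = []"
    using a assms(2) by (auto simp: filter_empty_conv)
  moreover have "\<not> n \<le> 1"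
    using a assms(2) by simp
  ultimately have "parts_ge n (add_row k a ?L) = parts_ge n ?L"
    by (simp add: parts_ge_def add_row_def)
  then show ?case
    using Cons by simp
qed

text \<open>Rows that skip all columns of height \<open>n\<close> act as if these columns were absent.\<close>

lemma columns_long_rows:
  assumes "\<forall>x\<in>set p. k - x < n" "mset (columns k q') = mset (columns k q) + replicate_mset m n"
  shows "mset (columns k (p @ q')) = mset (columns k (p @ q)) + replicate_mset m n"
  using assms(1)
proof (induction p)
  case Nil
  then show ?case using assms(2) by simp
next
  case (Cons a p)
  have "filter_mset (\<lambda>x. k - a < x) (replicate_mset m n) = replicate_mset m n"
    "filter_mset (\<lambda>x. x \<le> k - a) (replicate_mset m n) = {#}"
    using Cons.prems by (induction m) auto
  then show ?case
    using Cons by (simp add: mset_add_row del: filter_mset_eq_mempty_iff)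
qed

section \<open>The conjugate of a union with a rectangle\<close>

lemma nonincreasing_partition_union: "nonincreasing (partition_union p q)"
  by (simp add: partition_union_def sorted_wrt_rev)

lemma mset_partition_union [simp]: "mset (partition_union p q) = mset p + mset q"
  by (simp add: partition_union_def)

lemma partition_union_rectangle:
  assumes "nonincreasing p"
  shows "partition_union p (replicate n l)
    = filter (\<lambda>x. l < x) p @ replicate n l @ filter (\<lambda>x. x \<le> l) p"
proof (rule nonincreasing_unique[OF nonincreasing_partition_union])
  show "nonincreasing (filter (\<lambda>x. l < x) p @ replicate n l @ filter (\<lambda>x. x \<le> l) p)"
    using assms by (auto simp: sorted_wrt_append sorted_wrt_filter nonincreasing_replicate)
  show "mset (partition_union p (replicate n l))
      = mset (filter (\<lambda>x. l < x) p @ replicate n l @ filter (\<lambda>x. x \<le> l) p)"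
    using mset_split_at[of l "mset p"] by simp
qed

lemma part_1_le_iff: "nonincreasing p \<Longrightarrow> part p 1 \<le> b \<longleftrightarrow> (\<forall>x\<in>set p. x \<le> b)"
  by (cases p) (auto simp: Defs.part_def)

lemma partition_union_k_bounded:
  assumes "\<forall>x\<in>set r. 0 < x \<and> x \<le> k"
  shows "partition_union p r \<in> k_bounded_partitions k \<longleftrightarrow> (\<forall>x\<in>set p. 0 < x \<and> x \<le> k)"
  using assms nonincreasing_partition_union[of p r]
  by (auto simp: k_bounded_partitions_iff partition_union_def)

lemma filter_k_bounded: "p \<in> k_bounded_partitions k \<Longrightarrow> filter P p \<in> k_bounded_partitions k"
  by (auto simp: k_bounded_partitions_iff sorted_wrt_filter)

text \<open>The rows are inserted in increasing order of length: those of length at most \<open>l\<close>, then the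
rectangle, then the longer ones, which skip its columns.\<close>

lemma columns_partition_union_rectangle:
  assumes p: "p \<in> k_bounded_partitions k" and n: "n = Suc (k - l)"
  shows "mset (columns k (partition_union p (replicate n l))) = mset (columns k p) + replicate_mset l n"
proof -
  let ?A = "filter (\<lambda>x. l < x) p" and ?B = "filter (\<lambda>x. x \<le> l) p"
  have "nonincreasing p" using p by (simp add: k_bounded_partitions_iff)
  then have p_eq: "p = ?A @ ?B"
    using partition_union_rectangle[of p 0 l]
    by (intro nonincreasing_unique) (auto simp: sorted_wrt_append sorted_wrt_filter not_less[symmetric] )
  have "mset (columns k (replicate n l @ ?B)) = mset (columns k ?B) + replicate_mset l n"
    using p by (intro columns_full_rectangle filter_k_bounded n)
      (auto simp: part_1_le_iff[simplified] k_bounded_partitions_iff sorted_wrt_filter)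
  then have "mset (columns k (?A @ replicate n l @ ?B)) = mset (columns k (?A @ ?B)) + replicate_mset l n"
    by (intro columns_long_rows) (auto simp: n)
  then show ?thesis
    using partition_union_rectangle[OF \<open>nonincreasing p\<close>] p_eq by simp
qed

section \<open>Covers and chains\<close>

lemma parts_ge_union: "mset q = mset p + mset r \<Longrightarrow> parts_ge t q = parts_ge t p + parts_ge t r"
  by (simp add: parts_ge_mset)

lemma contained_union_iff:
  assumes "nonincreasing p" "nonincreasing q" "nonincreasing p'" "nonincreasing q'"
    "mset p' = mset p + mset r" "mset q' = mset q + mset r"
  shows "contained p' q' \<longleftrightarrow> contained p q"
  using assms by (simp add: contained_iff_parts_ge parts_ge_union[of p'] parts_ge_union[of q'])

lemma k_cover_partition_union_rectangle:
  assumes p: "p \<in> k_bounded_partitions k" and q: "q \<in> k_bounded_partitions k"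
    and l: "1 \<le> l" "l \<le> k" and n: "n = Suc (k - l)"
  shows "k_cover k (partition_union p (replicate n l)) (partition_union q (replicate n l)) \<longleftrightarrow> k_cover k p q"
proof -
  let ?u = "\<lambda>p. partition_union p (replicate n l)"
  have bounded: "?u p \<in> k_bounded_partitions k" "?u q \<in> k_bounded_partitions k"
    using p q l partition_union_k_bounded[of "replicate n l" k]
    by (simp_all add: k_bounded_partitions_iff[of p] k_bounded_partitions_iff[of q])
  have "contained (?u p) (?u q) \<longleftrightarrow> contained p q"
    using p q by (intro contained_union_iff[where r = "replicate n l"])
      (simp_all add: nonincreasing_partition_union k_bounded_partitions_iff)
  moreover have "contained (columns k (?u p)) (columns k (?u q)) \<longleftrightarrow> contained (columns k p) (columns k q)"
    using columns_partition_union_rectangle[OF p n] columns_partition_union_rectangle[OF q n]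
    by (intro contained_union_iff[where r = "replicate l n"]) (simp_all add: nonincreasing_columns)
  moreover have "sum_list (?u p) = sum_list p + n * l" for p
    by (simp add: sum_mset_sum_list[symmetric] sum_list_replicate)
  ultimately show ?thesis
    using p q bounded by (simp add: k_cover_def k_conjugate_eq_columns)
qed

text \<open>Losing the rectangle would mean that the added box turns one of exactly \<open>n\<close> parts \<open>l\<close> into \<open>l + 1\<close>.
The longer rows, including the one of length \<open>l + 1\<close>, create no column of height \<open>n\<close>, and the
\<open>n - 1\<close> remaining rows of length \<open>l\<close> create too few.\<close>

lemma k_cover_preserves_rectangle:
  assumes p: "p \<in> k_bounded_partitions k" and l: "1 \<le> l" "l \<le> k" and n: "n = Suc (k - l)"
    and cover: "k_cover k (partition_union p (replicate n l)) s"
  shows "replicate_mset n l \<subseteq># mset s"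
proof (rule ccontr)
  let ?u = "partition_union p (replicate n l)"
  assume "\<not> replicate_mset n l \<subseteq># mset s"
  then have few: "count (mset s) l < n"
    by (simp add: count_le_replicate_mset_subset_eq[symmetric] not_le)
  have dec: "nonincreasing p" using p by (simp add: k_bounded_partitions_iff)
  have s: "s \<in> k_bounded_partitions k" and u: "?u \<in> k_bounded_partitions k"
    and cont: "contained ?u s" and ccont: "contained (columns k ?u) (columns k s)"
    and sum: "sum_list s = sum_list ?u + 1"
    using cover by (auto simp: k_cover_def k_conjugate_eq_columns)
  have s': "nonincreasing s" using s by (simp add: k_bounded_partitions_iff)
  have le: "\<forall>t\<ge>1. parts_ge t ?u \<le> parts_ge t s"
    using cont contained_iff_parts_ge[OF nonincreasing_partition_union s'] by blast
  obtain t where t: "1 \<le> t" "parts_ge t s = parts_ge t ?u + 1"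
    and other: "\<And>i. 1 \<le> i \<Longrightarrow> i \<noteq> t \<Longrightarrow> parts_ge i s = parts_ge i ?u"
    using one_box_added[OF le sum] by blast
  have cnt: "count (mset ?u) l = count (mset p) l + n"
    by simp
  have cs: "parts_ge x s = parts_ge (Suc x) s + count (mset s) x"
    and cu: "parts_ge x ?u = parts_ge (Suc x) ?u + count (mset ?u) x" for x
    by (rule parts_ge_Suc)+
  \<comment> \<open>The number of parts \<open>l\<close> is a difference of consecutive values of \<open>parts_ge\<close>, and it decreases only
if the column of the new box is \<open>l + 1\<close>.\<close>
  have tl: "t = Suc l"
    using few cnt cs[of l] cu[of l] other[of l] other[of "Suc l"] t l by (cases "t = l") force+
  have "count (mset s) l + 1 = count (mset ?u) l"
    using cs[of l] cu[of l] other[of l] t l by (simp add: tl)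
  then have none: "count (mset p) l = 0"
    using few cnt by linarith
  have box: "mset s + {#l#} = mset ?u + {#Suc l#}"
  proof (rule multiset_eqI)
    fix x
    show "count (mset s + {#l#}) x = count (mset ?u + {#Suc l#}) x"
    proof (cases "x = 0")
      case True
      have "0 \<notin> set s" "0 \<notin> set ?u"
        using s u by (auto simp: k_bounded_partitions_iff)
      then have "0 \<notin># mset s + {#l#}" "0 \<notin># mset ?u + {#Suc l#}"
        using l by (auto simp del: mset_partition_union)
      then show ?thesis
        unfolding True by (metis not_in_iff)
    next
      case False
      then show ?thesis
        using cs[of x] cu[of x] other[of x] other[of "Suc x"] t l
        by (cases "x = l"; cases "x = Suc l") (auto simp: tl simp del: mset_partition_union)
    qed
  qed
  let ?A = "filter (\<lambda>x. l < x) p" and ?B = "filter (\<lambda>x. x \<le> l) p"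
  have B: "\<forall>x\<in>set ?B. x < l"
    using none by (auto simp: count_eq_zero_iff le_less)
  have u_eq: "?u = ?A @ replicate n l @ ?B"
    by (rule partition_union_rectangle[OF dec])
  have "Suc l \<in># mset s"
    using box by (metis add_mset_add_single multi_member_last n_not_Suc_n add_mset_remove_trivial_eq insert_noteq_member)
  then have "Suc l \<le> k"
    using s by (simp add: k_bounded_partitions_iff)
  have s_eq: "s = (?A @ [Suc l]) @ replicate (k - l) l @ ?B"
  proof (rule nonincreasing_unique[OF s'])
    show "nonincreasing ((?A @ [Suc l]) @ replicate (k - l) l @ ?B)"
      using dec by (auto simp: sorted_wrt_append sorted_wrt_filter nonincreasing_replicate)
    have "mset s + {#l#} = mset ((?A @ [Suc l]) @ replicate (k - l) l @ ?B) + {#l#}"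
      unfolding box using mset_split_at[of l "mset p"] by (simp add: n)
    then show "mset s = mset ((?A @ [Suc l]) @ replicate (k - l) l @ ?B)"
      by simp
  qed
  have "part ?B 1 < l"
    using B part_in_set[of ?B 1] l by (cases "part ?B 1 = 0") auto
  then have "parts_ge n (columns k (replicate (k - l) l @ ?B)) < parts_ge n (columns k (replicate n l @ ?B))"
    by (intro parts_ge_columns_broken_rectangle filter_k_bounded p n)
  moreover have "parts_ge n (columns k s) = parts_ge n (columns k (replicate (k - l) l @ ?B))"
    unfolding s_eq using p \<open>Suc l \<le> k\<close>
    by (intro parts_ge_columns_long_rows[where l = l] n) (auto simp: k_bounded_partitions_iff)
  moreover have "parts_ge n (columns k ?u) = parts_ge n (columns k (replicate n l @ ?B))"
    unfolding u_eq using p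
    by (intro parts_ge_columns_long_rows[where l = l] n) (auto simp: k_bounded_partitions_iff)
  moreover have "parts_ge n (columns k ?u) \<le> parts_ge n (columns k s)"
    using ccont n by (simp add: contained_iff_parts_ge nonincreasing_columns)
  ultimately show False
    by linarith
qed

text \<open>Every cover of a partition containing the rectangle is obtained from a cover of what is left when the
rectangle is removed, so chains can be lifted back step by step.\<close>

lemma k_cover_partition_unionE:
  assumes p: "p \<in> k_bounded_partitions k" and l: "1 \<le> l" "l \<le> k" and n: "n = Suc (k - l)"
    and cover: "k_cover k (partition_union p (replicate n l)) s"
  obtains q where "k_cover k p q" "s = partition_union q (replicate n l)"
proof -
  define q where "q = rev (sorted_list_of_multiset (mset s - replicate_mset n l))"
  have s: "s \<in> k_bounded_partitions k"
    using cover by (simp add: k_cover_def)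
  have mset_q: "mset s = mset q + mset (replicate n l)"
    using k_cover_preserves_rectangle[OF p l n cover] by (simp add: q_def)
  have s_eq: "s = partition_union q (replicate n l)"
    using s by (intro nonincreasing_unique nonincreasing_partition_union)
      (simp_all add: k_bounded_partitions_iff mset_q)
  have "set q \<subseteq> set s"
    using mset_q by (metis mset_subset_eq_add_left set_mset_mono set_mset_mset)
  then have "q \<in> k_bounded_partitions k"
    using s by (auto simp: k_bounded_partitions_iff q_def sorted_wrt_rev)
  then show ?thesis
    using that k_cover_partition_union_rectangle[OF p _ l n] cover s_eq by blast
qed

lemma partition_union_right_cancel:
  assumes "nonincreasing p" "nonincreasing q" "partition_union p r = partition_union q r"
  shows "p = q"
proof -
  have "mset p + mset r = mset q + mset r"
    by (metis assms(3) mset_partition_union)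
  then show ?thesis
    using assms by (intro nonincreasing_unique) simp_all
qed

theorem proposition19:
  fixes k :: nat and p q r :: "nat list"
  assumes "1 \<le> k"
    and "p \<in> k_bounded_partitions k"
    and "q \<in> k_bounded_partitions k"
    and "k_rectangle k r"
  shows "k_le k p q \<longleftrightarrow> k_le k (partition_union p r) (partition_union q r)"
proof -
  obtain l n where l: "1 \<le> l" "l \<le> k" and n: "n = Suc (k - l)" and r: "r = replicate n l"
    using assms(4) by (auto simp: k_rectangle_def)
  show ?thesis
  proof
    assume "k_le k p q"
    then have "(k_cover k)\<^sup>*\<^sup>* p q"
      by (simp add: k_le_def)
    then have "(k_cover k)\<^sup>*\<^sup>* (partition_union p r) (partition_union q r)"
    proof induction
      case (step x y)
      then have "k_cover k (partition_union x r) (partition_union y r)"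
        unfolding r using k_cover_partition_union_rectangle[OF _ _ l n] by (auto simp: k_cover_def)
      then show ?case
        using step.IH by simp
    qed simp
    then show "k_le k (partition_union p r) (partition_union q r)"
      by (simp add: k_le_def)
  next
    assume "k_le k (partition_union p r) (partition_union q r)"
    then have "(k_cover k)\<^sup>*\<^sup>* (partition_union p r) (partition_union q r)"
      by (simp add: k_le_def)
    then have "\<exists>q'. q' \<in> k_bounded_partitions k \<and> partition_union q r = partition_union q' r
        \<and> (k_cover k)\<^sup>*\<^sup>* p q'"
    proof induction
      case base
      then show ?case using assms(2) by blast
    next
      case (step x y)
      then obtain x' where x': "x' \<in> k_bounded_partitions k" "x = partition_union x' r"
        "(k_cover k)\<^sup>*\<^sup>* p x'"
        by blast
      obtain y' where y': "k_cover k x' y'" "y = partition_union y' r"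
        using k_cover_partition_unionE[OF x'(1) l n, of y] step.hyps(2) x'(2) unfolding r by blast
      then show ?case
        using rtranclp.rtrancl_into_rtrancl[OF x'(3) y'(1)] y' unfolding k_cover_def[of k x' y'] by blast
    qed
    then show "k_le k p q"
      using partition_union_right_cancel[of q _ r] assms(3)
      by (auto simp: k_le_def k_bounded_partitions_iff)
  qed
qed

end
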